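(* Let $m\ge1$, let $S=\{R_k : k=0,\dots,m-1\}$ be the group of planar rotations $R_k$ by angle $2\pi k/m$, and let $n\ge 1$. For every feature map $F:\mathbb{R}^2\times S\to\mathbb{R}^n$, every $\tilde R\in S$ and all $(x,R)\in\mathbb{R}^2\times S$, $$\Phi_{\mathrm{GN}}\left(\pi^F_{\tilde R}(F)\right)(x,R)=\left[\pi^F_{\tilde R}(\Phi_{\mathrm{GN}}(F))\right](x,R).$$
   Context: Rotation action: for a function $f$ on $\mathbb{R}^2\times S$ and $\tilde R\in S$, $[\pi^F_{\tilde R}(f)](x,R)=f(\tilde R^{-1}x,\tilde R^{-1}R)$. Group normalization: fix a partition $\{\mathcal{C}_g\}_{g=1}^{N_g}$ of the channel set $\{1,\dots,n\}$ into nonempty groups, a constant $\varepsilon>0$, and parameters $\gamma,\beta\in\mathbb{R}^n$ (not depending on $x$ or $R$). For $F(x,R)\in\mathbb{R}^n$, let $\mu(x,R),\sigma^2(x,R)\in\mathbb{R}^n$ be the vectors whose $c$-th entries, for $c\in\mathcal{C}_g$, are the mean and the variance of the numbers $\{F_{c'}(x,R): c'\in\mathcal{C}_g\}$. Then $$\Phi_{\mathrm{GN}}(F)(x,R)=\gamma\odot\frac{F(x,R)-\mu(x,R)}{\sqrt{\sigma^2(x,R)+\varepsilon}}+\beta,$$ where $\odot$, the quotient and the square root are entrywise. *)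

theory Defs
  imports "HOL-Analysis.Analysis" "HOL-Library.Disjoint_Sets" "HOL-Library.FuncSet"
begin

definition planar_rotation :: "real \<Rightarrow> real^2^2" where
  "planar_rotation t = vector [vector [cos t, - sin t], vector [sin t, cos t]]"

definition rotation_grp :: "nat \<Rightarrow> (real^2^2) set" where
  "rotation_grp m = {planar_rotation (2 * pi * real k / real m) | k. k < m}"

lemma planar_rotation_mult:
  "planar_rotation s ** planar_rotation t = planar_rotation (s + t)"
  by (simp add: planar_rotation_def matrix_matrix_mult_def vec_eq_iff forall_2 sum_2
      cos_add sin_add algebra_simps)

lemma planar_rotation_0: "planar_rotation 0 = mat 1"
  by (simp add: planar_rotation_def mat_def vec_eq_iff forall_2)

lemma planar_rotation_inv: "matrix_inv (planar_rotation t) = planar_rotation (- t)"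
proof -
  let ?A = "planar_rotation t" and ?B = "planar_rotation (- t)"
  have AB: "?A ** ?B = mat 1" "?B ** ?A = mat 1"
    by (simp_all add: planar_rotation_mult planar_rotation_0)
  have "?A ** matrix_inv ?A = mat 1 \<and> matrix_inv ?A ** ?A = mat 1"
    unfolding matrix_inv_def by (rule someI[of _ ?B]) (simp add: AB)
  then show ?thesis
    using AB(2) by (metis matrix_mul_assoc matrix_mul_lid matrix_mul_rid)
qed

lemma planar_rotation_in_rotation_grp:
  assumes "m \<ge> 1"
  shows "planar_rotation (2 * pi * of_int j / real m) \<in> rotation_grp m"
proof -
  define k where "k = nat (j mod int m)"
  define q where "q = j div int m"
  have k: "int k = j mod int m" "k < m"
    using assms by (auto simp: k_def nat_less_iff)
  have "j = q * int m + int k" by (simp add: q_def k(1))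
  then have "real_of_int j = of_int q * real m + real k"
    by (metis of_int_add of_int_mult of_int_of_nat_eq)
  then have e: "2 * pi * of_int j / real m = 2 * pi * real k / real m + 2 * pi * of_int q"
    using assms by (simp add: field_simps)
  have "planar_rotation (2 * pi * of_int j / real m) = planar_rotation (2 * pi * real k / real m)"
    unfolding e planar_rotation_def by (simp add: cos_add sin_add)
  with k(2) show ?thesis unfolding rotation_grp_def by blast
qed

lemma rotation_grp_one:
  assumes "m \<ge> 1" shows "mat 1 \<in> rotation_grp m"
  using planar_rotation_in_rotation_grp[OF assms, of 0] by (simp add: planar_rotation_0)

lemma rotation_grp_mult:
  assumes "A \<in> rotation_grp m" "B \<in> rotation_grp m"
  shows "A ** B \<in> rotation_grp m"
proof -
  obtain k l where kl: "k < m" "A = planar_rotation (2 * pi * real k / real m)"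
    "B = planar_rotation (2 * pi * real l / real m)"
    using assms unfolding rotation_grp_def by blast
  have "A ** B = planar_rotation (2 * pi * of_int (int k + int l) / real m)"
    by (simp add: kl planar_rotation_mult add_divide_distrib distrib_left)
  then show ?thesis using kl(1) by (simp only:) (rule planar_rotation_in_rotation_grp, simp)
qed

lemma rotation_grp_inv:
  assumes "A \<in> rotation_grp m"
  shows "matrix_inv A \<in> rotation_grp m"
proof -
  obtain k where k: "k < m" "A = planar_rotation (2 * pi * real k / real m)"
    using assms unfolding rotation_grp_def by blast
  have "matrix_inv A = planar_rotation (2 * pi * of_int (- int k) / real m)"
    by (simp add: k planar_rotation_inv)
  then show ?thesis using k(1) by (simp only:) (rule planar_rotation_in_rotation_grp, simp)
qed

text \<open>Functions with domain \<open>\<real>\<^sup>2 \<times> S\<close> are extensional functions; accordingly the operators below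
  return functions restricted to this domain.\<close>

abbreviation feature_dom :: "nat \<Rightarrow> ((real^2) \<times> (real^2^2)) set" where
  "feature_dom m \<equiv> UNIV \<times> rotation_grp m"

definition rot_action ::
  "nat \<Rightarrow> real^2^2 \<Rightarrow> ((real^2) \<times> (real^2^2) \<Rightarrow> 'b) \<Rightarrow> ((real^2) \<times> (real^2^2) \<Rightarrow> 'b)" where
  "rot_action m Q f = (\<lambda>(x, R)\<in>feature_dom m. f (matrix_inv Q *v x, matrix_inv Q ** R))"

text \<open>The type \<open>'n\<close> plays the role of the channel set, and \<open>P\<close> is its partition into groups.\<close>

definition channel_group :: "'n set set \<Rightarrow> 'n \<Rightarrow> 'n set" where
  "channel_group P c = (THE C. C \<in> P \<and> c \<in> C)"

lemma channel_group_eq: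
  assumes "partition_on UNIV P" "C \<in> P" "c \<in> C"
  shows "channel_group P c = C"
  unfolding channel_group_def
  using assms by (intro the_equality) (auto dest: partition_onD2 disjointD)

definition group_mean :: "'n set set \<Rightarrow> real^'n \<Rightarrow> real^'n" where
  "group_mean P v = (\<chi> c. (\<Sum>c'\<in>channel_group P c. v $ c') / real (card (channel_group P c)))"

text \<open>As usual for group normalization, this is the population variance (divisor \<open>|C|\<close>, not
  \<open>|C| - 1\<close>).\<close>

definition group_var :: "'n set set \<Rightarrow> real^'n \<Rightarrow> real^'n" where
  "group_var P v = (\<chi> c. (\<Sum>c'\<in>channel_group P c. (v $ c' - group_mean P v $ c)\<^sup>2)
                          / real (card (channel_group P c)))"

definition group_norm ::
  "nat \<Rightarrow> 'n set set \<Rightarrow> real \<Rightarrow> real^'n \<Rightarrow> real^'n \<Rightarrow>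
   ((real^2) \<times> (real^2^2) \<Rightarrow> real^'n) \<Rightarrow> ((real^2) \<times> (real^2^2) \<Rightarrow> real^'n)" where
  "group_norm m P \<epsilon> \<gamma> \<beta> F = (\<lambda>p\<in>feature_dom m.
     \<chi> c. \<gamma> $ c * ((F p $ c - group_mean P (F p) $ c) / sqrt (group_var P (F p) $ c + \<epsilon>)) + \<beta> $ c)"

end

theory Submission
  imports Defs
begin

text \<open>Group normalization is pointwise: its output at a point depends only on the channel
  vector there, through one fixed map of \<open>real^'n\<close>. The rotation action merely
  precomposes with a map of the domain, so the two commute.\<close>

theorem theorem3p3:
  fixes m :: nat
    and P :: "'n::finite set set"
    and \<epsilon> :: real
    and \<gamma> \<beta> :: "real^'n"
    and F :: "(real^2) \<times> (real^2^2) \<Rightarrow> real^'n"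
    and Q R :: "real^2^2"
    and x :: "real^2"
  assumes "m \<ge> 1"
    and "partition_on UNIV P"
    and "\<epsilon> > 0"
    and "F \<in> (UNIV \<times> rotation_grp m) \<rightarrow>\<^sub>E UNIV"
    and "Q \<in> rotation_grp m"
    and "R \<in> rotation_grp m"
  shows "group_norm m P \<epsilon> \<gamma> \<beta> (rot_action m Q F) (x, R)
       = rot_action m Q (group_norm m P \<epsilon> \<gamma> \<beta> F) (x, R)"
proof -
  \<comment> \<open>The rotated point must stay in \<open>feature_dom m\<close>; outside it the
    restricted function \<open>group_norm m P \<epsilon> \<gamma> \<beta> F\<close> is
    \<open>undefined\<close>.\<close>
  have "matrix_inv Q ** R \<in> rotation_grp m"
    using assms by (intro rotation_grp_mult rotation_grp_inv)
  then show ?thesis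
    using \<open>R \<in> rotation_grp m\<close> by (simp add: group_norm_def rot_action_def)
qed

end
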